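(* Let $E$ be a nonzero reflexive real Banach space and $S,T\colon E\rightrightarrows E^*$ be maximally monotone, and suppose $\bigcup_{\lambda>0}\lambda[\pi_1\mathrm{dom}\,\varphi_S-\pi_1\mathrm{dom}\,\varphi_T]$ is a closed linear subspace of $E$. Then $S+T$ is maximally monotone.
   Context: For a monotone multifunction $S$ with nonempty graph $G(S)$, its Fitzpatrick function is $\varphi_S(x,x^* ):=\sup_{(s,s^* )\in G(S)}[\langle x,s^*\rangle+\langle s,x^*\rangle-\langle s,s^*\rangle]$ on $E\times E^*$; $\mathrm{dom}\,\varphi_S:=\{(x,x^* )\colon\varphi_S(x,x^* )\in\mathbb{R}\}$, $\pi_1(x,x^* ):=x$. $(S+T)x:=\{y+z\colon y\in Sx,\ z\in Tx\}$. Maximal monotonicity is in the usual sense for graphs in $E\times E^*$. *)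

theory Defs
  imports "HOL-Analysis.Analysis"
begin

definition reflexive_space :: "('a::banach) itself \<Rightarrow> bool" where
  "reflexive_space _ \<longleftrightarrow>
     (\<forall>\<Phi> :: ('a \<Rightarrow>\<^sub>L real) \<Rightarrow>\<^sub>L real. \<exists>x::'a. \<forall>f. blinfun_apply \<Phi> f = blinfun_apply f x)"

definition graph :: "('a \<Rightarrow> ('a::real_normed_vector \<Rightarrow>\<^sub>L real) set) \<Rightarrow> ('a \<times> ('a \<Rightarrow>\<^sub>L real)) set" where
  "graph S = {(x, xs). xs \<in> S x}"

definition monotone_graph :: "('a::real_normed_vector \<times> ('a \<Rightarrow>\<^sub>L real)) set \<Rightarrow> bool" where
  "monotone_graph G \<longleftrightarrow>
     (\<forall>(x, xs) \<in> G. \<forall>(y, ys) \<in> G. blinfun_apply (xs - ys) (x - y) \<ge> 0)"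

definition maximal_monotone_graph :: "('a::real_normed_vector \<times> ('a \<Rightarrow>\<^sub>L real)) set \<Rightarrow> bool" where
  "maximal_monotone_graph G \<longleftrightarrow>
     monotone_graph G \<and> (\<forall>G'. monotone_graph G' \<and> G \<subseteq> G' \<longrightarrow> G' = G)"

definition maximal_monotone :: "('a \<Rightarrow> ('a::real_normed_vector \<Rightarrow>\<^sub>L real) set) \<Rightarrow> bool" where
  "maximal_monotone S \<longleftrightarrow> maximal_monotone_graph (graph S)"

definition fitzpatrick :: "('a \<Rightarrow> ('a::real_normed_vector \<Rightarrow>\<^sub>L real) set) \<Rightarrow> 'a \<times> ('a \<Rightarrow>\<^sub>L real) \<Rightarrow> ereal" where
  "fitzpatrick S = (\<lambda>(x, xs). SUP (s, ss) \<in> graph S.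
       ereal (blinfun_apply ss x + blinfun_apply xs s - blinfun_apply ss s))"

definition fitz_dom :: "('a \<Rightarrow> ('a::real_normed_vector \<Rightarrow>\<^sub>L real) set) \<Rightarrow> ('a \<times> ('a \<Rightarrow>\<^sub>L real)) set" where
  "fitz_dom S = {p. fitzpatrick S p \<noteq> \<infinity> \<and> fitzpatrick S p \<noteq> -\<infinity>}"

definition mf_sum :: "('a \<Rightarrow> ('a::real_normed_vector \<Rightarrow>\<^sub>L real) set) \<Rightarrow> ('a \<Rightarrow> ('a \<Rightarrow>\<^sub>L real) set) \<Rightarrow> 'a \<Rightarrow> ('a \<Rightarrow>\<^sub>L real) set" where
  "mf_sum S T = (\<lambda>x. {y + z | y z. y \<in> S x \<and> z \<in> T x})"

end

theory Submission
  imports Defs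
begin

text \<open>Let \<open>(m, ms)\<close> be monotonically related to \<open>S + T\<close>. The convex function
  \<open>\<phi>\<^sub>S(x, y) + \<phi>\<^sub>T(x, y') + \<bar>x - m\<bar>\<^sup>2/2 + \<bar>y + y' - ms\<bar>\<^sup>2/2 - \<langle>x, ms\<rangle> - \<langle>m, y + y'\<rangle> + \<langle>m, ms\<rangle>\<close>
  is nonnegative because Fitzpatrick functions dominate the duality pairing. Perturb it by decoupling
  the two copies of \<open>x\<close> and shifting the arguments of the two squares. By the Baire category theorem
  on the closed subspace, together with the successive-halving argument of the open mapping theorem, the
  perturbed infimum is bounded above near 0 along the subspace, so Hahn-Banach yields a continuous Lagrange multiplier. By
  reflexivity it is a triple \<open>(a, b, c)\<close> with \<open>c \<in> E\<close>, and evaluating it on the graphs gives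
  \<open>ms + a + b \<in> S (m - c)\<close>, \<open>- b \<in> T (m - c)\<close> and
  \<open>\<bar>a\<bar>\<^sup>2/2 + \<bar>c\<bar>\<^sup>2/2 \<le> \<langle>c, a\<rangle>\<close>. Since \<open>(m, ms)\<close> is monotonically related to
  \<open>(m - c, ms + a)\<close>, also \<open>\<langle>c, a\<rangle> \<le> 0\<close>, hence \<open>a = 0\<close> and \<open>c = 0\<close>.\<close>

section \<open>The Hahn-Banach theorem\<close>

definition sublinear :: "('a::real_vector \<Rightarrow> real) \<Rightarrow> bool" where
  "sublinear p \<longleftrightarrow> (\<forall>x y. p (x + y) \<le> p x + p y) \<and> (\<forall>t\<ge>0. \<forall>x. p (t *\<^sub>R x) = t * p x)"

lemma sublinear_add: "sublinear p \<Longrightarrow> p (x + y) \<le> p x + p y"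
  and sublinear_scale: "sublinear p \<Longrightarrow> t \<ge> 0 \<Longrightarrow> p (t *\<^sub>R x) = t * p x"
  unfolding sublinear_def by blast+

lemma sublinear_zero: "sublinear p \<Longrightarrow> p 0 = 0"
  using sublinear_scale[of p 0 0] by simp

lemma sublinear_minus: "sublinear p \<Longrightarrow> - p (- x) \<le> p x"
  using sublinear_add[of p x "- x"] sublinear_zero[of p] by simp

text \<open>Infima yield one-sided estimates, so the conditions are inequalities.
  \<open>scale\<close> at \<open>inverse t\<close> gives the reverse inequality, and at
  \<open>1/2\<close> with \<open>x = 0\<close> it gives \<open>p 0 \<le> 0\<close>.\<close>

lemma sublinearI:
  assumes add: "\<And>x y. p (x + y) \<le> p x + p y"
    and scale: "\<And>t x. t > 0 \<Longrightarrow> p (t *\<^sub>R x) \<le> t * p x"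
    and zero: "p 0 \<ge> 0"
  shows "sublinear p"
proof -
  have p0: "p 0 = 0"
    using scale[of "1/2" 0] zero by simp
  have "p (t *\<^sub>R x) = t * p x" if "t > 0" for t x
  proof (rule antisym[OF scale[OF that]])
    have "p x \<le> inverse t * p (t *\<^sub>R x)"
      using scale[of "inverse t" "t *\<^sub>R x"] that by simp
    then show "t * p x \<le> p (t *\<^sub>R x)"
      using that by (simp add: field_simps)
  qed
  then have "p (t *\<^sub>R x) = t * p x" if "t \<ge> 0" for t x
    using that p0 by (cases "t = 0") auto
  then show ?thesis
    unfolding sublinear_def using add by blast
qed

text \<open>The minorant is the infimum over \<open>t \<ge> 0\<close> of
  \<open>p (x + t *\<^sub>R z) - t * p z\<close>. Subadditivity bounds these values below by
  \<open>- p (- x)\<close>, so the infimum is finite; \<open>t = 0\<close> gives the bound by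
  \<open>p\<close>, and \<open>t = 1\<close> the value at \<open>- z\<close>.\<close>

lemma sublinear_directional_minorant:
  assumes p: "sublinear p"
  obtains q where "sublinear q" "\<And>x. q x \<le> p x" "q (- z) \<le> - p z"
proof
  define q where "q x = (INF t\<in>{0..}. p (x + t *\<^sub>R z) - t * p z)" for x
  have low: "- p (- x) \<le> p (x + t *\<^sub>R z) - t * p z" if "t \<ge> 0" for x t
    using sublinear_add[OF p, of "x + t *\<^sub>R z" "- x"] sublinear_scale[OF p that, of z] by simp
  have bdd: "bdd_below ((\<lambda>t. p (x + t *\<^sub>R z) - t * p z) ` {0..})" for x
    using low by (intro bdd_belowI2) auto
  have q_le: "q x \<le> p (x + t *\<^sub>R z) - t * p z" if "t \<ge> 0" for x t
    unfolding q_def using that by (intro cINF_lower bdd) auto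
  have q_ge: "c \<le> q x" if "\<And>t. t \<ge> 0 \<Longrightarrow> c \<le> p (x + t *\<^sub>R z) - t * p z" for x c
    unfolding q_def using that by (intro cINF_greatest) auto
  show "q x \<le> p x" for x
    using q_le[of 0 x] by simp
  show "q (- z) \<le> - p z"
    using q_le[of 1 "- z"] sublinear_zero[OF p] by simp
  show "sublinear q"
  proof (rule sublinearI)
    fix x y
    have "q (x + y) - (p (y + u *\<^sub>R z) - u * p z) \<le> p (x + t *\<^sub>R z) - t * p z"
      if "t \<ge> 0" "u \<ge> 0" for t u
      using q_le[of "t + u" "x + y"] that sublinear_add[OF p, of "x + t *\<^sub>R z" "y + u *\<^sub>R z"]
      by (simp add: algebra_simps)
    then have "q (x + y) - (p (y + u *\<^sub>R z) - u * p z) \<le> q x" if "u \<ge> 0" for u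
      using q_ge[of "q (x + y) - (p (y + u *\<^sub>R z) - u * p z)" x] that by blast
    then have "q (x + y) - q x \<le> q y"
      using q_ge[of "q (x + y) - q x" y] by (simp add: algebra_simps)
    then show "q (x + y) \<le> q x + q y" by simp
  next
    fix t :: real and x assume t: "t > 0"
    have "inverse t * q (t *\<^sub>R x) \<le> p (x + s *\<^sub>R z) - s * p z" if "s \<ge> 0" for s
      using q_le[of "t * s" "t *\<^sub>R x"] that t sublinear_scale[OF p, of t "x + s *\<^sub>R z"]
      by (simp add: scaleR_add_right field_simps)
    then have "inverse t * q (t *\<^sub>R x) \<le> q x"
      using q_ge[of "inverse t * q (t *\<^sub>R x)" x] by blast
    then show "q (t *\<^sub>R x) \<le> t * q x"
      using t by (simp add: field_simps)
  next
    show "0 \<le> q 0"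
      using low[of _ 0] sublinear_zero[OF p] by (intro q_ge) auto
  qed
qed

text \<open>The chain condition enters through subadditivity: two members have a common minorant in
  \<open>C\<close>, to which the inequality applies. The lower bound \<open>- p (- x)\<close> keeps
  the pointwise infimum finite.\<close>

lemma sublinear_INF_chain:
  assumes ne: "C \<noteq> {}"
    and sub: "\<And>f. f \<in> C \<Longrightarrow> sublinear f"
    and chain: "\<And>f g. f \<in> C \<Longrightarrow> g \<in> C \<Longrightarrow> f \<le> g \<or> g \<le> f"
    and low: "\<And>f. f \<in> C \<Longrightarrow> f \<le> p"
  shows "sublinear (\<lambda>x. INF f\<in>C. f x)" "\<And>f. f \<in> C \<Longrightarrow> (\<lambda>x. INF f\<in>C. f x) \<le> f"
proof -
  have "- p (- x) \<le> f x" if "f \<in> C" for f x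
    using sublinear_minus[OF sub[OF that], of x] le_funD[OF low[OF that], of "- x"] by linarith
  then have bdd: "bdd_below ((\<lambda>f. f x) ` C)" for x
    by (intro bdd_belowI2) auto
  have le: "(INF f\<in>C. f x) \<le> f x" if "f \<in> C" for f x
    using that by (intro cINF_lower bdd)
  then show "\<And>f. f \<in> C \<Longrightarrow> (\<lambda>x. INF f\<in>C. f x) \<le> f"
    by (auto simp: le_fun_def)
  have ge: "c \<le> (INF f\<in>C. f x)" if "\<And>f. f \<in> C \<Longrightarrow> c \<le> f x" for x c
    using that ne by (intro cINF_greatest) auto
  show "sublinear (\<lambda>x. INF f\<in>C. f x)"
  proof (rule sublinearI)
    fix x y
    let ?i = "\<lambda>x. INF f\<in>C. f x"
    have "?i (x + y) - g y \<le> f x" if fg: "f \<in> C" "g \<in> C" for f g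
    proof -
      obtain h where h: "h \<in> C" "h \<le> f" "h \<le> g"
        using chain[OF fg] fg by blast
      then show ?thesis
        using le[OF h(1), of "x + y"] sublinear_add[OF sub[OF h(1)], of x y]
          le_funD[OF h(2), of x] le_funD[OF h(3), of y] by linarith
    qed
    then have "?i (x + y) - g y \<le> ?i x" if "g \<in> C" for g
      using that by (intro ge) auto
    then have "?i (x + y) - ?i x \<le> g y" if "g \<in> C" for g
      using that by (simp add: algebra_simps)
    then have "?i (x + y) - ?i x \<le> ?i y"
      by (intro ge) auto
    then show "?i (x + y) \<le> ?i x + ?i y" by simp
  next
    fix t :: real and x assume t: "t > 0"
    have "inverse t * (INF f\<in>C. f (t *\<^sub>R x)) \<le> g x" if "g \<in> C" for g
      using le[OF that, of "t *\<^sub>R x"] sublinear_scale[OF sub[OF that], of t x] t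
      by (simp add: field_simps)
    then have "inverse t * (INF f\<in>C. f (t *\<^sub>R x)) \<le> (INF f\<in>C. f x)"
      by (intro ge) auto
    then show "(INF f\<in>C. f (t *\<^sub>R x)) \<le> t * (INF f\<in>C. f x)"
      using t by (simp add: field_simps)
  next
    show "0 \<le> (INF f\<in>C. f 0)"
      using sub sublinear_zero by (intro ge) fastforce
  qed
qed

text \<open>A minimal sublinear functional is linear, because it coincides with each of its
  directional minorants.\<close>
theorem hahn_banach_sublinear:
  assumes p: "sublinear p"
  obtains f :: "'a::real_vector \<Rightarrow> real" where "linear f" "\<And>x. f x \<le> p x"
proof -
  define A where "A = {q. sublinear q \<and> q \<le> p}"
  have "\<exists>m\<in>A. \<forall>a\<in>A. a \<le> m \<longrightarrow> a = m"
  \<comment> \<open>The order is reversed, so bounds of chains are pointwise infima and a maximal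
    element is a minimal sublinear functional.\<close>
  proof (rule predicate_Zorn)
    show "partial_order_on A (relation_of (\<lambda>f g. g \<le> f) A)"
      by (rule partial_order_on_relation_ofI) auto
    fix C assume C: "C \<in> Chains (relation_of (\<lambda>f g. g \<le> f) A)"
    then have CA: "C \<subseteq> A" and chain: "\<And>f g. f \<in> C \<Longrightarrow> g \<in> C \<Longrightarrow> f \<le> g \<or> g \<le> f"
      unfolding Chains_def relation_of_def by blast+
    show "\<exists>u\<in>A. \<forall>a\<in>C. u \<le> a"
    proof (cases "C = {}")
      case True
      then show ?thesis using p by (auto simp: A_def)
    next
      case False
      have sub: "\<And>f. f \<in> C \<Longrightarrow> sublinear f" and low: "\<And>f. f \<in> C \<Longrightarrow> f \<le> p"
        using CA by (auto simp: A_def)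
      have inf: "sublinear (\<lambda>x. INF f\<in>C. f x)" "\<And>f. f \<in> C \<Longrightarrow> (\<lambda>x. INF f\<in>C. f x) \<le> f"
        using sublinear_INF_chain[of C p] False sub chain low by blast+
      obtain f where f: "f \<in> C" using False by blast
      have "(\<lambda>x. INF f\<in>C. f x) \<le> p"
        using inf(2)[OF f] low[OF f] by (rule order_trans)
      then show ?thesis
        using inf by (intro bexI[of _ "\<lambda>x. INF f\<in>C. f x"]) (auto simp: A_def)
    qed
  qed
  then obtain m where m: "sublinear m" "m \<le> p"
    and min: "\<And>q. sublinear q \<Longrightarrow> q \<le> p \<Longrightarrow> q \<le> m \<Longrightarrow> q = m"
    unfolding A_def by blast
  have odd: "m (- z) = - m z" for z
  proof -
    obtain q where q: "sublinear q" "\<And>x. q x \<le> m x" "q (- z) \<le> - m z"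
      using sublinear_directional_minorant[OF m(1), of z] by blast
    have "q \<le> m" using q(2) by (simp add: le_fun_def)
    then have "q = m"
      using min q(1) m(2) order_trans by blast
    then show ?thesis
      using q(3) sublinear_minus[OF m(1), of "z"] by simp
  qed
  have "linear m"
  proof (rule linearI)
    show "m (x + y) = m x + m y" for x y
      using sublinear_add[OF m(1), of x y] sublinear_add[OF m(1), of "- x" "- y"]
        odd[of x] odd[of y] odd[of "x + y"] by simp
    show "m (t *\<^sub>R x) = t *\<^sub>R m x" for t x
      using sublinear_scale[OF m(1), of t x] sublinear_scale[OF m(1), of "- t" x] odd[of "t *\<^sub>R x"]
      by (cases "t \<ge> 0") auto
  qed
  then show ?thesis
    using that m(2) by (auto simp: le_fun_def)
qed

text \<open>Passing from the norm to its directional minorant at \<open>x\<close> before applying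
  Hahn-Banach builds in \<open>g (- x) \<le> - norm x\<close>, hence
  \<open>g x = norm x\<close>.\<close>

lemma norming_functional:
  obtains f :: "'a::real_normed_vector \<Rightarrow>\<^sub>L real" where "norm f \<le> 1" "blinfun_apply f x = norm x"
proof -
  have "sublinear (norm :: 'a \<Rightarrow> real)"
    by (auto simp: sublinear_def norm_triangle_ineq)
  then obtain q :: "'a \<Rightarrow> real"
    where q: "sublinear q" "\<And>y. q y \<le> norm y" "q (- x) \<le> - norm x"
    using sublinear_directional_minorant by blast
  obtain g where g: "linear g" "\<And>y. g y \<le> q y"
    using hahn_banach_sublinear[OF q(1)] by blast
  have neg: "g (- y) = - g y" for y
    using g(1) by (rule linear_neg)
  have le: "g y \<le> norm y" for y
    using g(2) q(2) order_trans by blast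
  have abs: "\<bar>g y\<bar> \<le> norm y * 1" for y
    using le[of y] le[of "- y"] neg[of y] by simp
  have bl: "bounded_linear g"
    using g(1) abs
    by (intro bounded_linear_intro[of _ 1]) (auto simp: linear_add linear_scale)
  show ?thesis
  proof
    show "norm (Blinfun g) \<le> 1"
      using abs by (intro norm_blinfun_bound) (auto simp: bounded_linear_Blinfun_apply[OF bl])
    show "blinfun_apply (Blinfun g) x = norm x"
      using le[of x] g(2)[of "- x"] q(3) neg[of x] by (simp add: bounded_linear_Blinfun_apply[OF bl])
  qed
qed

section \<open>Lagrange multipliers\<close>

text \<open>The exact penalty condition says that the infimum below is a sublinear functional
  bounded by a multiple of the norm.\<close>
lemma exact_penalty_multiplier:
  fixes W :: "('a::real_normed_vector \<times> real) set"
  assumes W: "convex W" and K: "K \<ge> 0"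
    and pen: "\<And>d a. (d, a) \<in> W \<Longrightarrow> 0 \<le> a + K * norm d"
  obtains f :: "'a \<Rightarrow>\<^sub>L real" where "\<And>d a. (d, a) \<in> W \<Longrightarrow> blinfun_apply f d \<le> a"
proof (cases "W = {}")
  case True
  then show ?thesis using that[of 0] by simp
next
  case False
  define I where "I = {0::real<..} \<times> W"
  \<comment> \<open>The infimum \<open>p\<close> of these values is the infimal convolution of the
    positively homogeneous hull of \<open>W\<close> with \<open>K * norm\<close>: points of
    \<open>W\<close> are dilated by \<open>t > 0\<close>, and the mismatch in the first coordinate
    is penalized.\<close>
  define v where "v z = (\<lambda>(t, d, a). t * a + K * norm (z - t *\<^sub>R d))" for z :: 'a
  define p where "p z = (INF i\<in>I. v z i)" for z
  have I: "I \<noteq> {}" using False by (auto simp: I_def)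
  have low: "- K * norm z \<le> v z i" if "i \<in> I" for z i
  proof -
    obtain t d a where i: "i = (t, d, a)" by (cases i)
    have t: "t > 0" and da: "(d, a) \<in> W" using that by (auto simp: I_def i)
    have "t * norm d \<le> norm (z - t *\<^sub>R d) + norm z"
      using norm_triangle_ineq2[of "t *\<^sub>R d" z] t by (simp add: norm_minus_commute)
    then have "K * (t * norm d) \<le> K * (norm (z - t *\<^sub>R d) + norm z)"
      using K by (rule mult_left_mono)
    moreover have "0 \<le> t * (a + K * norm d)"
      using t pen[OF da] by simp
    ultimately show ?thesis
      by (simp add: i v_def algebra_simps)
  qed
  have bdd: "bdd_below (v z ` I)" for z
    using low by (intro bdd_belowI2)
  have p_le: "p z \<le> v z i" if "i \<in> I" for z i
    unfolding p_def using that by (intro cINF_lower bdd)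
  have p_ge: "c \<le> p z" if "\<And>i. i \<in> I \<Longrightarrow> c \<le> v z i" for z c
    unfolding p_def using that I by (intro cINF_greatest)
  \<comment> \<open>Dilates by \<open>t\<close> and \<open>s\<close> add up to the dilate by
    \<open>t + s\<close> of the convex combination with weights proportional to \<open>t\<close> and
    \<open>s\<close>.\<close>
  have merge: "\<exists>k\<in>I. v (x + y) k \<le> v x i + v y j" if ij: "i \<in> I" "j \<in> I" for x y i j
  proof -
    obtain t d a where i: "i = (t, d, a)" by (cases i)
    obtain s e b where j: "j = (s, e, b)" by (cases j)
    have ts: "t > 0" "s > 0" and WW: "(d, a) \<in> W" "(e, b) \<in> W" using ij by (auto simp: I_def i j)
    let ?d = "(t / (t + s)) *\<^sub>R d + (s / (t + s)) *\<^sub>R e"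
    let ?a = "(t / (t + s)) * a + (s / (t + s)) * b"
    have "(t / (t + s)) *\<^sub>R (d, a) + (s / (t + s)) *\<^sub>R (e, b) \<in> W"
      using ts by (intro convexD[OF W] WW) (auto simp flip: add_divide_distrib)
    then have mem: "(t + s, ?d, ?a) \<in> I"
      using ts by (simp add: I_def)
    have d: "(t + s) *\<^sub>R ?d = t *\<^sub>R d + s *\<^sub>R e" and a: "(t + s) * ?a = t * a + s * b"
      using ts by (simp_all add: scaleR_add_right distrib_left)
    have "v (x + y) (t + s, ?d, ?a) = t * a + s * b + K * norm ((x - t *\<^sub>R d) + (y - s *\<^sub>R e))"
      unfolding v_def prod.case d a by (simp add: algebra_simps)
    also have "\<dots> \<le> t * a + s * b + K * (norm (x - t *\<^sub>R d) + norm (y - s *\<^sub>R e))"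
      using K by (intro add_left_mono mult_left_mono norm_triangle_ineq)
    also have "\<dots> = v x i + v y j"
      by (simp add: i j v_def algebra_simps)
    finally show ?thesis using mem by blast
  qed
  have "sublinear p"
  proof (rule sublinearI)
    fix x y
    have "p (x + y) - v y j \<le> v x i" if "i \<in> I" "j \<in> I" for i j
      using merge[OF that, of x y] p_le[of _ "x + y"] by fastforce
    then have "p (x + y) - v y j \<le> p x" if "j \<in> I" for j
      using that by (intro p_ge) auto
    then have "p (x + y) - p x \<le> v y j" if "j \<in> I" for j
      using that by (simp add: algebra_simps)
    then have "p (x + y) - p x \<le> p y"
      by (intro p_ge) auto
    then show "p (x + y) \<le> p x + p y" by simp
  next
    fix t :: real and x :: 'a assume t: "t > 0"
    have "inverse t * p (t *\<^sub>R x) \<le> v x i" if "i \<in> I" for i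
    proof -
      obtain s d a where i: "i = (s, d, a)" by (cases i)
      have "(t * s, d, a) \<in> I" using that t by (auto simp: I_def i)
      then have "p (t *\<^sub>R x) \<le> v (t *\<^sub>R x) (t * s, d, a)" by (rule p_le)
      also have "\<dots> = t * s * a + K * norm (t *\<^sub>R (x - s *\<^sub>R d))"
        by (simp add: v_def scaleR_diff_right)
      also have "\<dots> = t * v x i"
        using t unfolding norm_scaleR by (simp add: v_def i algebra_simps)
      finally show ?thesis using t by (simp add: field_simps)
    qed
    then have "inverse t * p (t *\<^sub>R x) \<le> p x"
      by (intro p_ge) auto
    then show "p (t *\<^sub>R x) \<le> t * p x"
      using t by (simp add: field_simps)
  next
    show "0 \<le> p 0"
      using low[of _ 0] by (intro p_ge) auto
  qed
  then obtain g where g: "linear g" "\<And>x. g x \<le> p x"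
    using hahn_banach_sublinear by blast
  obtain d0 a0 where W0: "(d0, a0) \<in> W" using False by auto
  \<comment> \<open>The index \<open>t = 0\<close> is excluded, so \<open>norm x * K\<close> is
    approached by letting \<open>t\<close> tend to 0 at a fixed point of \<open>W\<close>. The
    choice \<open>t = e / (c + 1)\<close> keeps the error \<open>t * c\<close> below
    \<open>e\<close>, also when \<open>c = 0\<close>.\<close>
  have p_norm: "p x \<le> norm x * K" for x
  proof (rule field_le_epsilon)
    fix e :: real assume e: "e > 0"
    define c where "c = a0 + K * norm d0"
    have c: "c \<ge> 0" using pen[OF W0] by (simp add: c_def)
    define t where "t = e / (c + 1)"
    have t: "t > 0" "t * c \<le> e" using e c by (auto simp: t_def field_simps)
    have "p x \<le> v x (t, d0, a0)"
      using t(1) W0 by (intro p_le) (auto simp: I_def)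
    also have "\<dots> \<le> t * a0 + K * (norm x + t * norm d0)"
      unfolding v_def using K norm_triangle_ineq4[of x "t *\<^sub>R d0"] t(1)
      by (auto intro!: mult_left_mono)
    also have "\<dots> = norm x * K + t * c"
      by (simp add: c_def algebra_simps)
    finally show "p x \<le> norm x * K + e" using t(2) by linarith
  qed
  have abs: "\<bar>g x\<bar> \<le> norm x * K" for x
    using g(2)[of x] p_norm[of x] g(2)[of "- x"] p_norm[of "- x"] linear_neg[OF g(1), of x] by simp
  have bl: "bounded_linear g"
    using g(1) abs by (intro bounded_linear_intro[of _ K]) (auto simp: linear_add linear_scale)
  show ?thesis
  proof
    fix d a assume da: "(d, a) \<in> W"
    have "g d \<le> p d" by (rule g)
    also have "\<dots> \<le> v d (1, d, a)" using da by (intro p_le) (auto simp: I_def)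
    also have "\<dots> = a" by (simp add: v_def)
    finally show "blinfun_apply (Blinfun g) d \<le> a"
      by (simp add: bounded_linear_Blinfun_apply[OF bl])
  qed
qed

text \<open>A point of \<open>W\<close> over \<open>d\<close> and a bounded-height point over the opposite direction
  combine convexly to a point over 0, which bounds the first one below by a multiple of the norm of \<open>d\<close>.\<close>
lemma lagrange_multiplier:
  fixes W :: "('a::real_normed_vector \<times> real) set"
  assumes W: "convex W" and r: "r > 0"
    and zero: "\<And>a. (0, a) \<in> W \<Longrightarrow> 0 \<le> a"
    and qual: "\<And>d a. (d, a) \<in> W \<Longrightarrow> d \<noteq> 0 \<Longrightarrow> \<exists>m\<le>M. (- (r / norm d) *\<^sub>R d, m) \<in> W"
  obtains f :: "'a \<Rightarrow>\<^sub>L real" where "\<And>d a. (d, a) \<in> W \<Longrightarrow> blinfun_apply f d \<le> a"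
proof -
  have "0 \<le> a + \<bar>M\<bar> / r * norm d" if da: "(d, a) \<in> W" for d a
  proof (cases "d = 0")
    case True
    then show ?thesis using zero da by simp
  next
    case False
    obtain m where m: "m \<le> M" "(- (r / norm d) *\<^sub>R d, m) \<in> W"
      using qual[OF da False] by blast
    let ?n = "norm d"
    have n: "?n > 0" using False by simp
    have rn: "r + ?n \<noteq> 0" using r n by linarith
    have "(r / (r + ?n)) *\<^sub>R (d, a) + (?n / (r + ?n)) *\<^sub>R (- (r / ?n) *\<^sub>R d, m) \<in> W"
      using r n rn by (intro convexD[OF W da m(2)]) (simp_all flip: add_divide_distrib)
    moreover have "(r / (r + ?n)) *\<^sub>R d + (?n / (r + ?n)) *\<^sub>R (- (r / ?n) *\<^sub>R d) = 0"
      using n by simp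
    ultimately have "(0, (r / (r + ?n)) * a + (?n / (r + ?n)) * m) \<in> W"
      unfolding scaleR_Pair add_Pair real_scaleR_def by metis
    then have "0 \<le> (r / (r + ?n)) * a + (?n / (r + ?n)) * m"
      by (rule zero)
    also have "\<dots> = (r * a + ?n * m) / (r + ?n)"
      by (simp add: add_divide_distrib)
    finally have "0 \<le> r * a + ?n * m"
      using r n by (simp add: zero_le_divide_iff)
    also have "\<dots> \<le> r * a + ?n * \<bar>M\<bar>"
      using m(1) n by (intro add_left_mono mult_left_mono) auto
    finally show ?thesis using r by (simp add: field_simps)
  qed
  then show ?thesis
    using exact_penalty_multiplier[OF W, of "\<bar>M\<bar> / r"] r that by auto
qed

section \<open>Absorbing unions of closed convex sets\<close>

text \<open>The weights \<open>1/2\<close>, ..., \<open>(1/2)^n\<close> and the leftover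
  \<open>(1/2)^n\<close> sum to 1. The induction takes the midpoint of \<open>c 0\<close> and the
  sum for the shifted sequence.\<close>

lemma convex_dyadic_sum_mem:
  fixes C :: "'a::real_vector set"
  assumes C: "convex C" and c: "\<And>k. c k \<in> C" and u: "u \<in> C"
  shows "(\<Sum>k<n. (1/2)^Suc k *\<^sub>R c k) + (1/2)^n *\<^sub>R u \<in> C"
  using c
proof (induction n arbitrary: c)
  case 0
  then show ?case using u by simp
next
  case (Suc n)
  let ?s = "(\<Sum>k<n. (1/2)^Suc k *\<^sub>R c (Suc k)) + (1/2)^n *\<^sub>R u"
  have "(1/2) *\<^sub>R c 0 + (1/2) *\<^sub>R ?s \<in> C"
    using Suc.IH[of "\<lambda>k. c (Suc k)"] Suc.prems by (intro convexD[OF C]) auto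
  moreover have "(1/2) *\<^sub>R c 0 + (1/2) *\<^sub>R ?s
      = (\<Sum>k<Suc n. (1/2)^Suc k *\<^sub>R c k) + (1/2)^Suc n *\<^sub>R u"
    by (simp add: sum.lessThan_Suc_shift scaleR_add_right scaleR_sum_right del: sum.lessThan_Suc)
  ultimately show ?case by simp
qed

text \<open>Boundedness gives absolute convergence. The partial sums completed by
  \<open>(1/2)^n *\<^sub>R c 0\<close> stay in \<open>C\<close>, and this correction tends to 0, so
  closedness puts the limit in \<open>C\<close>.\<close>

lemma closed_convex_dyadic_series_mem:
  fixes C :: "'a::banach set"
  assumes C: "convex C" "closed C" "bounded C" and c: "\<And>k. c k \<in> C"
  shows "summable (\<lambda>k. (1/2)^Suc k *\<^sub>R c k)" "(\<Sum>k. (1/2)^Suc k *\<^sub>R c k) \<in> C"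
proof -
  obtain B where B: "\<And>x. x \<in> C \<Longrightarrow> norm x \<le> B"
    using C(3) by (auto simp: bounded_iff)
  have g: "summable (\<lambda>k. (1/2::real)^Suc k * B)"
    using summable_mult2[OF summable_geometric[of "1/2::real"], of "B / 2"] by (simp add: mult_ac)
  show s: "summable (\<lambda>k. (1/2)^Suc k *\<^sub>R c k)"
  proof (rule summable_comparison_test'[OF g])
    show "norm ((1/2)^Suc k *\<^sub>R c k) \<le> (1/2)^Suc k * B" for k
    proof -
      have "(1/2::real)^Suc k * norm (c k) \<le> (1/2)^Suc k * B"
        by (rule mult_left_mono[OF B[OF c]]) simp
      then show ?thesis by (simp only: norm_scaleR) simp
    qed
  qed
  have "(\<lambda>n. (\<Sum>k<n. (1/2)^Suc k *\<^sub>R c k) + (1/2)^n *\<^sub>R c 0)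
      \<longlonglongrightarrow> (\<Sum>k. (1/2)^Suc k *\<^sub>R c k) + 0 *\<^sub>R c 0"
    by (rule tendsto_add[OF summable_LIMSEQ[OF s]
        tendsto_scaleR[OF LIMSEQ_power_zero tendsto_const]]) simp
  then show "(\<Sum>k. (1/2)^Suc k *\<^sub>R c k) \<in> C"
    unfolding scaleR_zero_left add_0_right
    by (rule closed_sequentially[OF C(2) convex_dyadic_sum_mem[OF C(1) c c]])
qed

text \<open>The successive-halving step of the open mapping theorem, with the convex set \<open>C\<close> in place
  of the unit ball.\<close>
lemma image_contains_half_ball:
  fixes f :: "'a::banach \<Rightarrow> 'b::real_normed_vector"
  assumes f: "bounded_linear f" and F: "subspace F" and C: "convex C" "closed C" "bounded C"
    and fC: "f ` C \<subseteq> F" and r: "r > 0"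
    and dense: "\<And>y. y \<in> F \<Longrightarrow> norm y < r \<Longrightarrow> y \<in> closure (f ` C)"
    and y: "y \<in> F" "norm y < r"
  shows "(1/2) *\<^sub>R y \<in> f ` C"
proof -
  interpret f: bounded_linear f by (rule f)
  have ex: "\<exists>c\<in>C. norm (z - f c) < r / 2" if "z \<in> F" "norm z < r" for z
  proof -
    have "\<exists>y\<in>f ` C. dist y z < r / 2"
      using dense[OF that] r unfolding closure_approachable by (meson half_gt_zero)
    then show ?thesis by (auto simp: dist_norm norm_minus_commute)
  qed
  then obtain pick where pick: "\<And>z. z \<in> F \<Longrightarrow> norm z < r \<Longrightarrow> pick z \<in> C \<and> norm (z - f (pick z)) < r / 2"
    by (metis (no_types))
  \<comment> \<open>\<open>z n\<close> is the error left after \<open>n\<close> approximations,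
    rescaled. Each approximation leaves less than \<open>r / 2\<close>, so doubling brings it back
    below \<open>r\<close>.\<close>
  define z where "z = rec_nat y (\<lambda>_ z. 2 *\<^sub>R (z - f (pick z)))"
  have z0: "z 0 = y" and zS: "\<And>n. z (Suc n) = 2 *\<^sub>R (z n - f (pick (z n)))"
    by (simp_all add: z_def)
  have z: "z n \<in> F \<and> norm (z n) < r" for n
  proof (induction n)
    case 0
    then show ?case using y z0 by simp
  next
    case (Suc n)
    then have "z n - f (pick (z n)) \<in> F"
      using fC pick[of "z n"] by (intro subspace_diff[OF F]) auto
    then show ?case
      using pick[of "z n"] Suc by (auto simp: zS intro!: subspace_scale[OF F])
  qed
  let ?c = "\<lambda>k. pick (z k)"
  have c: "?c k \<in> C" for k using pick z by blast
  note series = closed_convex_dyadic_series_mem[OF C, of ?c, OF c]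
  \<comment> \<open>The coefficients start at \<open>1/2\<close>, so that they sum to 1 and the
    series stays in \<open>C\<close>. This is why the limit is half of \<open>y\<close>.\<close>
  have partial: "f (\<Sum>k<n. (1/2)^Suc k *\<^sub>R ?c k) = (1/2) *\<^sub>R y - (1/2)^Suc n *\<^sub>R z n" for n
  proof (induction n)
    case 0
    then show ?case by (simp add: z0 f.zero)
  next
    case (Suc n)
    have "f (\<Sum>k<Suc n. (1/2)^Suc k *\<^sub>R ?c k)
        = (1/2) *\<^sub>R y - (1/2)^Suc n *\<^sub>R z n + (1/2)^Suc n *\<^sub>R f (?c n)"
      unfolding sum.lessThan_Suc f.add Suc.IH f.scaleR ..
    then show ?case
      by (simp add: zS scaleR_diff_right)
  qed
  have "(\<lambda>n. f (\<Sum>k<n. (1/2)^Suc k *\<^sub>R ?c k)) \<longlonglongrightarrow> f (\<Sum>k. (1/2)^Suc k *\<^sub>R ?c k)"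
    by (intro f.tendsto summable_LIMSEQ series)
  moreover have "(\<lambda>n. (1/2)^Suc n *\<^sub>R z n) \<longlonglongrightarrow> 0"
  proof (rule Lim_null_comparison)
    show "\<forall>\<^sub>F n in sequentially. norm ((1/2)^Suc n *\<^sub>R z n) \<le> (1/2)^Suc n * r"
      using z by (intro always_eventually) (simp add: less_imp_le)
    have "(\<lambda>n. (1/2::real)^Suc n * r) \<longlonglongrightarrow> 0 * r"
      by (rule tendsto_mult[OF LIMSEQ_Suc[OF LIMSEQ_power_zero] tendsto_const]) simp
    then show "(\<lambda>n. (1/2::real)^Suc n * r) \<longlonglongrightarrow> 0" by simp
  qed
  then have "(\<lambda>n. f (\<Sum>k<n. (1/2)^Suc k *\<^sub>R ?c k)) \<longlonglongrightarrow> (1/2) *\<^sub>R y - 0"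
    unfolding partial by (intro tendsto_diff tendsto_const)
  ultimately have "f (\<Sum>k. (1/2)^Suc k *\<^sub>R ?c k) = (1/2) *\<^sub>R y - 0"
    by (rule LIMSEQ_unique)
  then have "(1/2) *\<^sub>R y = f (\<Sum>k. (1/2)^Suc k *\<^sub>R ?c k)" by simp
  then show ?thesis
    using series(2) by (rule image_eqI)
qed

text \<open>A closed subset of a complete space is completely metrizable, and \<open>F\<close> is
  its own interior in its subspace topology. If every \<open>F \<inter> D n\<close> had empty
  relative interior, Baire would contradict this.\<close>

lemma Baire_closed_subset_cover:
  fixes F :: "'a::complete_space set"
  assumes F: "closed F" "F \<noteq> {}" and D: "\<And>n::nat. closed (D n)" and cover: "F \<subseteq> (\<Union>n. D n)"
  obtains n x e where "e > 0" "x \<in> F" "\<And>y. y \<in> F \<Longrightarrow> dist y x < e \<Longrightarrow> y \<in> D n"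
proof -
  let ?X = "top_of_set F"
  let ?G = "range (\<lambda>n. F \<inter> D n)"
  have "completely_metrizable_space ?X"
    using F(1) by (simp add: completely_metrizable_space_closedin completely_metrizable_space_euclidean)
  moreover have "\<Union>?G = F" using cover by auto
  moreover have "?X interior_of F = F"
    using interior_of_topspace[of ?X] by simp
  ultimately have "\<exists>T\<in>?G. \<not> (closedin ?X T \<and> ?X interior_of T = {})"
    using Baire_category_alt[of ?X ?G] F(2) by force
  then obtain n where n: "?X interior_of (F \<inter> D n) \<noteq> {}"
    using D by (auto simp: closedin_closed_Int)
  then obtain x where x: "x \<in> ?X interior_of (F \<inter> D n)" by blast
  have "openin ?X (?X interior_of (F \<inter> D n))" by simp
  then obtain e where "e > 0" "\<And>y. y \<in> F \<Longrightarrow> dist y x < e \<Longrightarrow> y \<in> ?X interior_of (F \<inter> D n)"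
    using x unfolding openin_euclidean_subtopology_iff by metis
  moreover have "?X interior_of (F \<inter> D n) \<subseteq> D n" "x \<in> F"
    using interior_of_subset[of ?X "F \<inter> D n"] x by auto
  ultimately show ?thesis by (intro that[of e x n]) auto
qed

text \<open>Baire gives a relative ball around some \<open>x\<close> inside a dilate of the closure
  of an image. Since \<open>- x\<close> lies in another dilate, averaging moves the ball to 0, and
  successive halving removes the closure. Nestedness and the common point 0 allow both dilates to be
  compared in one set.\<close>

lemma absorbing_image_contains_ball:
  fixes f :: "'a::banach \<Rightarrow> 'b::banach" and C :: "nat \<Rightarrow> 'a set"
  assumes f: "bounded_linear f" and F: "subspace F" "closed F"
    and C: "\<And>n. convex (C n)" "\<And>n. closed (C n)" "\<And>n. bounded (C n)" and mono: "mono C"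
    and fC: "\<And>n. f ` C n \<subseteq> F" and zero: "0 \<in> f ` C 0"
    and absorb: "\<And>y. y \<in> F \<Longrightarrow> \<exists>t>0. \<exists>n. \<exists>u\<in>C n. y = t *\<^sub>R f u"
  obtains r n where "r > 0" "\<And>y. y \<in> F \<Longrightarrow> norm y < r \<Longrightarrow> y \<in> f ` C n"
proof -
  interpret f: bounded_linear f by (rule f)
  define K where "K n = closure (f ` C n)" for n
  have fC_mono: "f ` C n \<subseteq> f ` C j" if "n \<le> j" for n j
    using monoD[OF mono that] by blast
  have K_mono: "K n \<subseteq> K j" if "n \<le> j" for n j
    unfolding K_def using fC_mono[OF that] by (rule closure_mono)
  have K_convex: "convex (K n)" for n
    unfolding K_def by (intro convex_closure convex_linear_image C f.linear)
  have fC_K: "f ` C n \<subseteq> K n" for n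
    unfolding K_def by (rule closure_subset)
  have K_scale: "t *\<^sub>R y \<in> K n" if "y \<in> K n" "0 \<le> t" "t \<le> 1" for t y n
  proof -
    have "0 \<in> K n" using zero fC_K[of 0] K_mono[of 0 n] by auto
    then have "t *\<^sub>R y + (1 - t) *\<^sub>R 0 \<in> K n"
      using that by (intro convexD[OF K_convex]) auto
    then show ?thesis by simp
  qed
  \<comment> \<open>The real factor \<open>t\<close> is rounded up to an integer to make the cover
    countable; the set index is raised along with it.\<close>
  have cover: "\<exists>n. \<exists>p\<in>K n. y = real (Suc n) *\<^sub>R p" if yF: "y \<in> F" for y
  proof -
    obtain t n u where t: "t > 0" and u: "u \<in> C n" and y: "y = t *\<^sub>R f u"
      using absorb[OF yF] by blast
    define j where "j = max n (nat \<lceil>t\<rceil>)"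
    have j: "n \<le> j" "t \<le> real (Suc j)"
      unfolding j_def by linarith+
    have "f u \<in> K j"
      using u fC_K[of n] K_mono[OF j(1)] by blast
    then have "(t / real (Suc j)) *\<^sub>R f u \<in> K j"
      using t j(2) by (intro K_scale) auto
    moreover have "y = real (Suc j) *\<^sub>R ((t / real (Suc j)) *\<^sub>R f u)"
      by (simp add: y)
    ultimately show ?thesis by blast
  qed
  have "F \<noteq> {}" using subspace_0[OF F(1)] by blast
  moreover have "closed ((\<lambda>p. real (Suc n) *\<^sub>R p) ` K n)" for n
    unfolding K_def by (intro closed_scaling closed_closure)
  moreover have "F \<subseteq> (\<Union>n. (\<lambda>p. real (Suc n) *\<^sub>R p) ` K n)"
    using cover by fast
  ultimately obtain n x e where e: "e > 0" and x: "x \<in> F"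
    and ball: "\<And>y. y \<in> F \<Longrightarrow> dist y x < e \<Longrightarrow> y \<in> (\<lambda>p. real (Suc n) *\<^sub>R p) ` K n"
    using Baire_closed_subset_cover[OF F(2), of "\<lambda>n. (\<lambda>p. real (Suc n) *\<^sub>R p) ` K n"] by metis
  obtain k q where q: "q \<in> K k" "- x = real (Suc k) *\<^sub>R q"
    using cover[OF subspace_neg[OF F(1) x]] by blast
  define j where "j = max n k"
  define N where "N = real (Suc j)"
  have N: "N > 0" "real (Suc n) \<le> N" "real (Suc k) \<le> N" "n \<le> j" "k \<le> j"
    by (auto simp: N_def j_def)
  \<comment> \<open>With this radius \<open>x + (2 * N) *\<^sub>R y\<close> stays within
    \<open>e\<close> of \<open>x\<close>, and \<open>y\<close> is the midpoint of that point and
    \<open>- x\<close>, both divided by \<open>N\<close>.\<close>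
  define \<rho> where "\<rho> = e / (2 * N)"
  have \<rho>: "\<rho> > 0" using e N by (simp add: \<rho>_def)
  have dense: "y \<in> closure (f ` C j)" if y: "y \<in> F" "norm y < \<rho>" for y
  proof -
    have "x + (2 * N) *\<^sub>R y \<in> F"
      using x y by (intro subspace_add[OF F(1)] subspace_scale[OF F(1)])
    moreover have "dist (x + (2 * N) *\<^sub>R y) x < e"
      using y(2) N(1) by (simp add: dist_norm \<rho>_def field_simps)
    ultimately obtain p where p: "p \<in> K n" "x + (2 * N) *\<^sub>R y = real (Suc n) *\<^sub>R p"
      using ball by blast
    have "(real (Suc n) / N) *\<^sub>R p \<in> K j" "(real (Suc k) / N) *\<^sub>R q \<in> K j"
      using p(1) q(1) K_mono[OF N(4)] K_mono[OF N(5)] N(1-3) by (auto intro!: K_scale)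
    then have "(1/2) *\<^sub>R ((real (Suc n) / N) *\<^sub>R p) + (1/2) *\<^sub>R ((real (Suc k) / N) *\<^sub>R q) \<in> K j"
      by (intro convexD[OF K_convex]) auto
    also have "(1/2) *\<^sub>R ((real (Suc n) / N) *\<^sub>R p) + (1/2) *\<^sub>R ((real (Suc k) / N) *\<^sub>R q)
        = (1 / (2 * N)) *\<^sub>R (real (Suc n) *\<^sub>R p) + (1 / (2 * N)) *\<^sub>R (real (Suc k) *\<^sub>R q)"
      by simp
    also have "\<dots> = y"
      unfolding p(2)[symmetric] q(2)[symmetric] using N(1) by (simp add: scaleR_add_right)
    finally show ?thesis by (simp add: K_def)
  qed
  show ?thesis
  proof
    show "\<rho> / 2 > 0" using \<rho> by simp
    fix y assume y: "y \<in> F" "norm y < \<rho> / 2"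
    have "(1/2) *\<^sub>R (2 *\<^sub>R y) \<in> f ` C j"
      using y by (intro image_contains_half_ball[OF f F(1) C fC \<rho> dense] subspace_scale[OF F(1)]) auto
    then show "y \<in> f ` C j" by simp
  qed
qed

section \<open>Half squares of norms and their conjugates\<close>

lemma norm_convex_combination_square:
  fixes x y :: "'a::real_normed_vector"
  assumes "u \<ge> 0" "v \<ge> 0" "u + v = 1"
  shows "(norm (u *\<^sub>R x + v *\<^sub>R y))\<^sup>2 \<le> u * (norm x)\<^sup>2 + v * (norm y)\<^sup>2"
proof -
  have "norm (u *\<^sub>R x + v *\<^sub>R y) \<le> u * norm x + v * norm y"
    using norm_triangle_ineq[of "u *\<^sub>R x" "v *\<^sub>R y"] assms by simp
  then have "(norm (u *\<^sub>R x + v *\<^sub>R y))\<^sup>2 \<le> (u * norm x + v * norm y)\<^sup>2"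
    by (rule power_mono) simp
  also have "\<dots> \<le> u * (norm x)\<^sup>2 + v * (norm y)\<^sup>2"
  proof -
    have "u = 1 - v" using assms(3) by simp
    have "u * (norm x)\<^sup>2 + v * (norm y)\<^sup>2 - (u * norm x + v * norm y)\<^sup>2 = u * v * (norm x - norm y)\<^sup>2"
      unfolding \<open>u = 1 - v\<close> by (simp add: power2_eq_square algebra_simps)
    then show ?thesis using assms(1,2) by (smt (verit) mult_nonneg_nonneg zero_le_power2)
  qed
  finally show ?thesis .
qed

lemma pairing_bound:
  fixes f :: "'a::real_normed_vector \<Rightarrow>\<^sub>L real"
  shows "- ((norm x)\<^sup>2 / 2 + (norm f)\<^sup>2 / 2) \<le> blinfun_apply f x"
proof -
  have "\<bar>blinfun_apply f x\<bar> \<le> norm f * norm x"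
    using norm_blinfun[of f x] by simp
  also have "\<dots> \<le> (norm x)\<^sup>2 / 2 + (norm f)\<^sup>2 / 2"
    using sum_squares_bound[of "norm f" "norm x"] by simp
  finally show ?thesis by linarith
qed

text \<open>The conjugate of half the squared norm is half the squared dual norm. On each line
  through 0 the hypothesis is a quadratic inequality in \<open>t\<close>, used at its
  minimizer.\<close>

lemma half_norm_square_conjugate_le:
  fixes f :: "'a::real_normed_vector \<Rightarrow>\<^sub>L real"
  assumes "\<And>h. 0 \<le> c + (norm h)\<^sup>2 / 2 + blinfun_apply f h"
  shows "(norm f)\<^sup>2 / 2 \<le> c"
proof -
  have c: "0 \<le> c" using assms[of 0] by simp
  have "(blinfun_apply f x)\<^sup>2 \<le> 2 * c * (norm x)\<^sup>2" for x
  proof (cases "x = 0")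
    case False
    define t where "t = - blinfun_apply f x / (norm x)\<^sup>2"
    have n: "(norm x)\<^sup>2 > 0" using False by simp
    have "0 \<le> c + t\<^sup>2 * (norm x)\<^sup>2 / 2 + t * blinfun_apply f x"
      using assms[of "t *\<^sub>R x"] by (simp add: blinfun.scaleR_right power_mult_distrib)
    also have "\<dots> = c - (blinfun_apply f x)\<^sup>2 / (2 * (norm x)\<^sup>2)"
      using n by (simp add: t_def field_simps power2_eq_square)
    finally show ?thesis using n by (simp add: field_simps)
  qed simp
  then have "\<bar>blinfun_apply f x\<bar> \<le> sqrt (2 * c) * norm x" for x
    by (metis real_le_rsqrt real_sqrt_abs real_sqrt_le_iff real_sqrt_mult abs_norm_cancel)
  then have "norm f \<le> sqrt (2 * c)"
    using c by (intro norm_blinfun_bound) auto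
  then have "(norm f)\<^sup>2 \<le> (sqrt (2 * c))\<^sup>2"
    by (rule power_mono) simp
  then show ?thesis using c by simp
qed

text \<open>The supremum defining the conjugate is tested at \<open>norm x\<close> times a norming
  functional of \<open>x\<close>.\<close>

lemma half_dual_norm_square_conjugate_le:
  fixes x :: "'a::real_normed_vector"
  assumes "\<And>k :: 'a \<Rightarrow>\<^sub>L real. 0 \<le> c + (norm k)\<^sup>2 / 2 - blinfun_apply k x"
  shows "(norm x)\<^sup>2 / 2 \<le> c"
proof -
  obtain f :: "'a \<Rightarrow>\<^sub>L real" where f: "norm f \<le> 1" "blinfun_apply f x = norm x"
    using norming_functional by blast
  have "(norm x * norm f)\<^sup>2 \<le> (norm x * 1)\<^sup>2"
    using f(1) by (intro power_mono mult_left_mono) auto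
  moreover have "0 \<le> c + (norm x * norm f)\<^sup>2 / 2 - (norm x)\<^sup>2"
    using assms[of "norm x *\<^sub>R f"] f(2) by (simp add: blinfun.scaleR_left power2_eq_square)
  ultimately show ?thesis unfolding mult_1_right by linarith
qed

section \<open>Sublevel sets of Fitzpatrick functions\<close>

text \<open>For the graph of \<open>S\<close> this says
  \<open>fitzpatrick S (x, y) \<le> ereal \<alpha>\<close>, with the supremum unfolded into real
  inequalities to avoid extended real arithmetic.\<close>

definition fitz_sublevel :: "('a::real_normed_vector \<times> ('a \<Rightarrow>\<^sub>L real)) set \<Rightarrow> real \<Rightarrow> ('a \<times> ('a \<Rightarrow>\<^sub>L real)) set" where
  "fitz_sublevel G \<alpha> = {(x, y). \<forall>(s, t)\<in>G. blinfun_apply t x + blinfun_apply y s - blinfun_apply t s \<le> \<alpha>}"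

lemma mem_fitz_sublevel:
  "(x, y) \<in> fitz_sublevel G \<alpha> \<longleftrightarrow>
     (\<forall>s t. (s, t) \<in> G \<longrightarrow> blinfun_apply t x + blinfun_apply y s - blinfun_apply t s \<le> \<alpha>)"
  unfolding fitz_sublevel_def by auto

lemma fitz_sublevel_mono: "\<alpha> \<le> \<beta> \<Longrightarrow> fitz_sublevel G \<alpha> \<subseteq> fitz_sublevel G \<beta>"
  unfolding fitz_sublevel_def by fastforce

text \<open>Every defining inequality is affine in \<open>(x, y)\<close>. Keeping the two levels
  apart expresses convexity of the epigraph, not merely of each sublevel set.\<close>

lemma fitz_sublevel_convex_comb:
  assumes xy: "(x, y) \<in> fitz_sublevel G \<alpha>" and xy': "(x', y') \<in> fitz_sublevel G \<beta>"
    and uv: "u \<ge> 0" "v \<ge> 0" "u + v = 1"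
  shows "(u *\<^sub>R x + v *\<^sub>R x', u *\<^sub>R y + v *\<^sub>R y') \<in> fitz_sublevel G (u * \<alpha> + v * \<beta>)"
  unfolding mem_fitz_sublevel
proof (intro allI impI)
  fix s t assume st: "(s, t) \<in> G"
  let ?A = "\<lambda>x y. blinfun_apply t x + blinfun_apply y s - blinfun_apply t s"
  have "?A (u *\<^sub>R x + v *\<^sub>R x') (u *\<^sub>R y + v *\<^sub>R y') = u * ?A x y + v * ?A x' y'"
  proof -
    have "v = 1 - u" using uv(3) by simp
    show ?thesis
      unfolding \<open>v = 1 - u\<close> by (simp add: blinfun.add_left blinfun.add_right blinfun.scaleR_left blinfun.scaleR_right
          blinfun.diff_left blinfun.diff_right algebra_simps)
  qed
  also have "\<dots> \<le> u * \<alpha> + v * \<beta>"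
    using xy xy' st uv unfolding mem_fitz_sublevel by (intro add_mono mult_left_mono) auto
  finally show "?A (u *\<^sub>R x + v *\<^sub>R x') (u *\<^sub>R y + v *\<^sub>R y') \<le> u * \<alpha> + v * \<beta>" .
qed

lemma convex_fitz_sublevel: "convex (fitz_sublevel G \<alpha>)"
proof (rule convexI)
  fix p q and u v :: real
  assume pq: "p \<in> fitz_sublevel G \<alpha>" "q \<in> fitz_sublevel G \<alpha>" and uv: "0 \<le> u" "0 \<le> v" "u + v = 1"
  have "u * \<alpha> + v * \<alpha> = \<alpha>" using uv(3) by (metis distrib_right mult_1)
  then show "u *\<^sub>R p + v *\<^sub>R q \<in> fitz_sublevel G \<alpha>"
    using fitz_sublevel_convex_comb[of "fst p" "snd p" G \<alpha> "fst q" "snd q" \<alpha> u v] pq uv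
    by (simp add: plus_prod_def scaleR_prod_def)
qed

lemma closed_fitz_sublevel: "closed (fitz_sublevel G \<alpha>)"
proof -
  have "fitz_sublevel G \<alpha> = (\<Inter>(s, t)\<in>G. {p. blinfun_apply t (fst p) + blinfun_apply (snd p) s - blinfun_apply t s \<le> \<alpha>})"
    unfolding fitz_sublevel_def by auto
  then show ?thesis
    by (auto intro!: closed_INT closed_Collect_le continuous_intros)
qed

lemma fitz_sublevel_of_fitz_dom:
  assumes "(x, y) \<in> fitz_dom S"
  obtains \<alpha> where "(x, y) \<in> fitz_sublevel (graph S) \<alpha>"
proof -
  obtain \<alpha> where \<alpha>: "fitzpatrick S (x, y) = ereal \<alpha>"
    using assms by (cases "fitzpatrick S (x, y)") (auto simp: fitz_dom_def)
  have "ereal (blinfun_apply t x + blinfun_apply y s - blinfun_apply t s) \<le> ereal \<alpha>"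
    if "(s, t) \<in> graph S" for s t
    unfolding \<alpha>[symmetric] fitzpatrick_def prod.case
    using that by (intro SUP_upper2[of "(s, t)"]) auto
  then show ?thesis
    by (intro that[of \<alpha>]) (auto simp: mem_fitz_sublevel)
qed

text \<open>The level bounds the supremum above; any point of the graph bounds it below and so
  excludes \<open>-\<infinity>\<close>.\<close>

lemma fitz_dom_of_fitz_sublevel:
  assumes G: "graph S \<noteq> {}" and xy: "(x, y) \<in> fitz_sublevel (graph S) \<alpha>"
  shows "(x, y) \<in> fitz_dom S"
proof -
  obtain s t where st: "(s, t) \<in> graph S" using G by auto
  have "fitzpatrick S (x, y) \<le> ereal \<alpha>"
    unfolding fitzpatrick_def prod.case using xy by (intro SUP_least) (auto simp: mem_fitz_sublevel)
  moreover have "ereal (blinfun_apply t x + blinfun_apply y s - blinfun_apply t s) \<le> fitzpatrick S (x, y)"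
    unfolding fitzpatrick_def prod.case using st by (intro SUP_upper2[of "(s, t)"]) auto
  ultimately show ?thesis
    by (auto simp: fitz_dom_def)
qed

section \<open>Maximal monotonicity and the duality pairing\<close>

lemma maximal_monotone_graph_memI:
  assumes G: "maximal_monotone_graph G"
    and rel: "\<And>s t. (s, t) \<in> G \<Longrightarrow> 0 \<le> blinfun_apply (t - y) (s - x)"
  shows "(x, y) \<in> G"
proof -
  have "0 \<le> blinfun_apply (y - t) (x - s)" if "(s, t) \<in> G" for s t
    using rel[OF that] by (simp add: blinfun.diff_left blinfun.diff_right algebra_simps)
  then have "monotone_graph (insert (x, y) G)"
    using G rel unfolding maximal_monotone_graph_def monotone_graph_def by auto
  then show ?thesis
    using G unfolding maximal_monotone_graph_def by blast
qed

text \<open>If the pairing exceeded \<open>\<alpha>\<close>, the point would be monotonically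
  related to all of \<open>G\<close> and hence belong to it. Its own defining inequality then bounds
  the pairing by \<open>\<alpha>\<close>.\<close>

lemma fitz_sublevel_ge_pairing:
  assumes G: "maximal_monotone_graph G" and xy: "(x, y) \<in> fitz_sublevel G \<alpha>"
  shows "blinfun_apply y x \<le> \<alpha>"
proof (rule ccontr)
  assume less: "\<not> blinfun_apply y x \<le> \<alpha>"
  have "(x, y) \<in> G"
  proof (rule maximal_monotone_graph_memI[OF G])
    fix s t assume "(s, t) \<in> G"
    then have "blinfun_apply t x + blinfun_apply y s - blinfun_apply t s \<le> \<alpha>"
      using xy by (simp add: mem_fitz_sublevel)
    then show "0 \<le> blinfun_apply (t - y) (s - x)"
      using less by (simp add: blinfun.diff_left blinfun.diff_right)
  qed
  then show False
    using xy less by (force simp: mem_fitz_sublevel)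
qed

text \<open>Expanded monotonicity. It supplies the test points at which the multiplier is
  evaluated.\<close>

lemma graph_subset_fitz_sublevel:
  assumes G: "monotone_graph G" and xy: "(x, y) \<in> G"
  shows "(x, y) \<in> fitz_sublevel G (blinfun_apply y x)"
  unfolding mem_fitz_sublevel
proof (intro allI impI)
  fix s t assume "(s, t) \<in> G"
  then have "0 \<le> blinfun_apply (y - t) (x - s)"
    using G xy unfolding monotone_graph_def by blast
  then show "blinfun_apply t x + blinfun_apply y s - blinfun_apply t s \<le> blinfun_apply y x"
    by (simp add: blinfun.diff_left blinfun.diff_right)
qed

text \<open>If some term from \<open>A\<close> is nonpositive, all terms from \<open>B\<close> are
  nonnegative, so \<open>(z, b)\<close> lies in \<open>B\<close>. Testing there makes the second
  term vanish, so no term from \<open>A\<close> can be negative and \<open>(x, a)\<close> lies in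
  \<open>A\<close>. Testing at \<open>(x, a)\<close> in turn gives
  \<open>(z, b) \<in> B\<close>.\<close>

lemma maximal_monotone_pair_mem:
  assumes A: "maximal_monotone_graph A" and B: "maximal_monotone_graph B" and R: "R \<ge> 0"
    and sum: "\<And>s t s' t'. (s, t) \<in> A \<Longrightarrow> (s', t') \<in> B \<Longrightarrow>
      R \<le> blinfun_apply (t - a) (s - x) + blinfun_apply (t' - b) (s' - z)"
  shows "(x, a) \<in> A" "(z, b) \<in> B"
proof -
  have B_mem: "(z, b) \<in> B" if "(s, t) \<in> A" "blinfun_apply (t - a) (s - x) \<le> 0" for s t
    using sum[OF that(1)] that(2) R by (intro maximal_monotone_graph_memI[OF B]) force
  show xa: "(x, a) \<in> A"
  proof (rule maximal_monotone_graph_memI[OF A], rule ccontr)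
    fix s t assume st: "(s, t) \<in> A" "\<not> 0 \<le> blinfun_apply (t - a) (s - x)"
    then have "(z, b) \<in> B" using B_mem[OF st(1)] by simp
    from sum[OF st(1) this] st(2) R show False by simp
  qed
  show "(z, b) \<in> B" using B_mem[OF xa] by simp
qed

section \<open>The cone of differences of the projected Fitzpatrick domains\<close>

definition fitz_dom_cone :: "('a \<Rightarrow> ('a::real_normed_vector \<Rightarrow>\<^sub>L real) set) \<Rightarrow> ('a \<Rightarrow> ('a \<Rightarrow>\<^sub>L real) set) \<Rightarrow> 'a set" where
  "fitz_dom_cone S T =
     (\<Union>c\<in>{0<..}. (\<lambda>v. c *\<^sub>R v) ` {a - b | a b. a \<in> fst ` fitz_dom S \<and> b \<in> fst ` fitz_dom T})"

lemma mem_fitz_dom_cone: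
  "d \<in> fitz_dom_cone S T \<longleftrightarrow>
     (\<exists>c>0. \<exists>x y x' y'. (x, y) \<in> fitz_dom S \<and> (x', y') \<in> fitz_dom T \<and> d = c *\<^sub>R (x - x'))"
  unfolding fitz_dom_cone_def by (force simp: image_iff)

text \<open>Over an empty graph the supremum is \<open>-\<infinity>\<close> everywhere, which would
  make the domain and the cone empty.\<close>

lemma fitz_dom_cone_graph_nonempty:
  assumes "0 \<in> fitz_dom_cone S T"
  shows "graph S \<noteq> {}" "graph T \<noteq> {}"
  using assms unfolding mem_fitz_dom_cone
  by (auto simp: fitz_dom_def fitzpatrick_def bot_ereal_def)

lemma fitz_sublevel_diff_in_fitz_dom_cone:
  assumes "0 \<in> fitz_dom_cone S T"
    and "(x, y) \<in> fitz_sublevel (graph S) \<alpha>" "(x', y') \<in> fitz_sublevel (graph T) \<beta>"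
  shows "x - x' \<in> fitz_dom_cone S T"
  using fitz_dom_of_fitz_sublevel[OF fitz_dom_cone_graph_nonempty(1)[OF assms(1)] assms(2)]
    fitz_dom_of_fitz_sublevel[OF fitz_dom_cone_graph_nonempty(2)[OF assms(1)] assms(3)]
  unfolding mem_fitz_dom_cone by (metis scaleR_one zero_less_one)

text \<open>The difference of first coordinates is a bounded linear map on a Banach space. Sublevel
  sets cut off by balls give nested closed bounded convex sets whose images absorb the cone. One
  constant \<open>c\<close> bounds levels and norms together.\<close>

lemma fitz_sublevel_differences_contain_ball:
  fixes S T :: "'a::banach \<Rightarrow> ('a \<Rightarrow>\<^sub>L real) set"
  assumes F: "subspace (fitz_dom_cone S T)" "closed (fitz_dom_cone S T)"
  obtains r c where "r > 0" "\<And>d. d \<in> fitz_dom_cone S T \<Longrightarrow> norm d < r \<Longrightarrow>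
    \<exists>x y x' y'. (x, y) \<in> fitz_sublevel (graph S) c \<and> (x', y') \<in> fitz_sublevel (graph T) c \<and>
      norm x \<le> c \<and> norm y \<le> c \<and> norm x' \<le> c \<and> norm y' \<le> c \<and> x - x' = d"
proof -
  have F0: "0 \<in> fitz_dom_cone S T" using F(1) by (rule subspace_0)
  define L :: "('a \<Rightarrow> ('a \<Rightarrow>\<^sub>L real) set) \<Rightarrow> real \<Rightarrow> _"
    where "L S c = fitz_sublevel (graph S) c \<inter> cball 0 c" for S c
  define f :: "('a \<times> ('a \<Rightarrow>\<^sub>L real)) \<times> ('a \<times> ('a \<Rightarrow>\<^sub>L real)) \<Rightarrow> 'a"
    where "f = (\<lambda>u. fst (fst u) - fst (snd u))"
  have f: "bounded_linear f"
    unfolding f_def by (intro bounded_linear_intros)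
  have L_mono: "L S c \<subseteq> L S c'" if "c \<le> c'" for S c c'
    using fitz_sublevel_mono[OF that] that by (auto simp: L_def)
  have level: "\<exists>\<alpha>. (x, y) \<in> L S \<alpha>" if xy: "(x, y) \<in> fitz_dom S" for x y S
  proof -
    obtain \<alpha> where \<alpha>: "(x, y) \<in> fitz_sublevel (graph S) \<alpha>"
      using fitz_sublevel_of_fitz_dom[OF xy] by blast
    then have "(x, y) \<in> L S (max \<alpha> (norm (x, y)))"
      using fitz_sublevel_mono[of \<alpha> "max \<alpha> (norm (x, y))"] by (auto simp: L_def)
    then show ?thesis by blast
  qed
  obtain c0 x0 y0 x1 y1 where 0: "c0 > 0" "(x0, y0) \<in> fitz_dom S" "(x1, y1) \<in> fitz_dom T"
    "0 = c0 *\<^sub>R (x0 - x1)"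
    using F0 unfolding mem_fitz_dom_cone by blast
  obtain \<alpha>0 \<beta>0 where lev0: "(x0, y0) \<in> L S \<alpha>0" "(x1, y1) \<in> L T \<beta>0"
    using level[OF 0(2)] level[OF 0(3)] by blast
  \<comment> \<open>The chosen pair has \<open>x0 = x1\<close>; starting the levels at
    \<open>b\<close> puts it in \<open>C 0\<close>, so 0 lies in every image.\<close>
  define b where "b = max \<alpha>0 \<beta>0"
  define C where "C n = L S (b + real n) \<times> L T (b + real n)" for n
  have convex_L: "convex (L S c)" and closed_L: "closed (L S c)" and bounded_L: "bounded (L S c)" for S c
    unfolding L_def
    by (intro convex_Int convex_fitz_sublevel convex_cball closed_Int closed_fitz_sublevel closed_cball
        bounded_Int disjI2 bounded_cball)+
  have C: "convex (C n)" "closed (C n)" "bounded (C n)" for n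
    unfolding C_def by (intro convex_Times closed_Times bounded_Times convex_L closed_L bounded_L)+
  have mono: "mono C"
    unfolding C_def by (intro monoI Sigma_mono L_mono) auto
  have fC: "f ` C n \<subseteq> fitz_dom_cone S T" for n
    using fitz_sublevel_diff_in_fitz_dom_cone[OF F0] by (auto simp: f_def C_def L_def)
  have zero: "0 \<in> f ` C 0"
  proof
    show "0 = f ((x0, y0), (x1, y1))" using 0(1,4) by (simp add: f_def)
    show "((x0, y0), (x1, y1)) \<in> C 0"
      using lev0 L_mono[of \<alpha>0 b S] L_mono[of \<beta>0 b T] by (auto simp: C_def b_def)
  qed
  have absorb: "\<exists>t>0. \<exists>n. \<exists>u\<in>C n. d = t *\<^sub>R f u" if d: "d \<in> fitz_dom_cone S T" for d
  proof -
    obtain t x y x' y' where t: "t > 0" "(x, y) \<in> fitz_dom S" "(x', y') \<in> fitz_dom T"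
      "d = t *\<^sub>R (x - x')"
      using d unfolding mem_fitz_dom_cone by blast
    obtain \<alpha> \<beta> where lev: "(x, y) \<in> L S \<alpha>" "(x', y') \<in> L T \<beta>"
      using level[OF t(2)] level[OF t(3)] by blast
    obtain n :: nat where "max \<alpha> \<beta> - b \<le> real n"
      using real_arch_simple by blast
    then have n: "\<alpha> \<le> b + real n" "\<beta> \<le> b + real n" by linarith+
    have "((x, y), (x', y')) \<in> C n"
      using lev L_mono[OF n(1)] L_mono[OF n(2)] by (auto simp: C_def)
    moreover have "d = t *\<^sub>R f ((x, y), (x', y'))" by (simp add: f_def t(4))
    ultimately show ?thesis using t(1) by blast
  qed
  obtain r n where r: "r > 0"
    and ball: "\<And>d. d \<in> fitz_dom_cone S T \<Longrightarrow> norm d < r \<Longrightarrow> d \<in> f ` C n"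
    using absorbing_image_contains_ball[OF f F C mono fC zero absorb] by blast
  show ?thesis
  proof (rule that[OF r, of "b + real n"])
    fix d assume "d \<in> fitz_dom_cone S T" "norm d < r"
    then have "d \<in> f ` C n" by (rule ball)
    then obtain x y x' y' where u: "((x, y), (x', y')) \<in> C n" "d = f ((x, y), (x', y'))"
      by (auto simp: image_iff Bex_def)
    have "norm x \<le> norm (x, y)" "norm y \<le> norm (x, y)" "norm x' \<le> norm (x', y')" "norm y' \<le> norm (x', y')"
      by (rule norm_fst_le norm_snd_le)+
    moreover have "norm (x, y) \<le> b + real n" "norm (x', y') \<le> b + real n"
      using u(1) by (auto simp: C_def L_def)
    ultimately show "\<exists>x y x' y'. (x, y) \<in> fitz_sublevel (graph S) (b + real n) \<and>
        (x', y') \<in> fitz_sublevel (graph T) (b + real n) \<and> norm x \<le> b + real n \<and> norm y \<le> b + real n \<and>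
        norm x' \<le> b + real n \<and> norm y' \<le> b + real n \<and> x - x' = d"
      using u by (intro exI[of _ x] exI[of _ y] exI[of _ x'] exI[of _ y']) (auto simp: C_def L_def f_def)
  qed
qed

section \<open>The perturbed minimization problem\<close>

text \<open>The part of the objective other than the Fitzpatrick functions, with \<open>w\<close> in the role of \<open>y + y'\<close>. At
  \<open>p = 0\<close>, \<open>q = 0\<close> it completes the pairing of \<open>w\<close> and \<open>x\<close> to the pairing of \<open>w - ms\<close>
  and \<open>x - m\<close> plus two half squares.\<close>
definition primal_value :: "'a::real_normed_vector \<Rightarrow> ('a \<Rightarrow>\<^sub>L real) \<Rightarrow> 'a \<Rightarrow> ('a \<Rightarrow>\<^sub>L real) \<Rightarrow>
    'a \<Rightarrow> ('a \<Rightarrow>\<^sub>L real) \<Rightarrow> real" where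
  "primal_value m ms p q x w = (norm (x - p - m))\<^sup>2 / 2 + (norm (w + q - ms))\<^sup>2 / 2
     - blinfun_apply ms x - blinfun_apply w m + blinfun_apply ms m"

text \<open>Convexity holds jointly in the shifts and the primal variables, as the perturbation
  argument requires: the squares are of norms of affine expressions, and the rest is affine.\<close>

lemma primal_value_convex_comb:
  assumes uv: "u \<ge> 0" "v \<ge> 0" "u + v = 1"
  shows "primal_value m ms (u *\<^sub>R p + v *\<^sub>R p') (u *\<^sub>R q + v *\<^sub>R q') (u *\<^sub>R x + v *\<^sub>R x') (u *\<^sub>R w + v *\<^sub>R w')
    \<le> u * primal_value m ms p q x w + v * primal_value m ms p' q' x' w'"
proof -
  have v: "v = 1 - u" using uv(3) by simp
  have 1: "u *\<^sub>R x + v *\<^sub>R x' - (u *\<^sub>R p + v *\<^sub>R p') - m = u *\<^sub>R (x - p - m) + v *\<^sub>R (x' - p' - m)"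
    unfolding v by (simp add: algebra_simps)
  have 2: "u *\<^sub>R w + v *\<^sub>R w' + (u *\<^sub>R q + v *\<^sub>R q') - ms = u *\<^sub>R (w + q - ms) + v *\<^sub>R (w' + q' - ms)"
    unfolding v by (simp add: algebra_simps)
  have 3: "- blinfun_apply ms (u *\<^sub>R x + v *\<^sub>R x') - blinfun_apply (u *\<^sub>R w + v *\<^sub>R w') m + blinfun_apply ms m
      = u * (- blinfun_apply ms x - blinfun_apply w m + blinfun_apply ms m)
      + v * (- blinfun_apply ms x' - blinfun_apply w' m + blinfun_apply ms m)"
    unfolding v by (simp add: blinfun.add_left blinfun.add_right blinfun.scaleR_left
        blinfun.scaleR_right blinfun.diff_left blinfun.diff_right algebra_simps)
  show ?thesis
    using norm_convex_combination_square[OF uv, of "x - p - m" "x' - p' - m"]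
      norm_convex_combination_square[OF uv, of "w + q - ms" "w' + q' - ms"] 3
    unfolding primal_value_def 1 2 by (simp add: algebra_simps)
qed

lemma pairing_add_primal_value_nonneg: "0 \<le> blinfun_apply w x + primal_value m ms 0 0 x w"
  using pairing_bound[of "x - m" "w - ms"]
  by (simp add: primal_value_def blinfun.diff_left blinfun.diff_right)

text \<open>Only the uniformity of the bound in \<open>p\<close>, \<open>q\<close>, \<open>x\<close>
  and \<open>w\<close> matters; it provides the common height for the multiplier argument.\<close>

lemma primal_value_le:
  assumes "norm p \<le> r" "norm q \<le> r" "norm x \<le> c" "norm w \<le> 2 * c"
  shows "primal_value m ms p q x w \<le> (c + r + norm m)\<^sup>2 / 2 + (2 * c + r + norm ms)\<^sup>2 / 2
    + norm ms * c + 2 * c * norm m + norm ms * norm m"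
proof -
  have "norm (x - p - m) \<le> c + r + norm m"
    using norm_triangle_ineq4[of "x - p" m] norm_triangle_ineq4[of x p] assms by linarith
  then have 1: "(norm (x - p - m))\<^sup>2 \<le> (c + r + norm m)\<^sup>2"
    by (rule power_mono) simp
  have "norm (w + q - ms) \<le> 2 * c + r + norm ms"
    using norm_triangle_ineq4[of "w + q" ms] norm_triangle_ineq[of w q] assms by linarith
  then have 2: "(norm (w + q - ms))\<^sup>2 \<le> (2 * c + r + norm ms)\<^sup>2"
    by (rule power_mono) simp
  have "\<bar>blinfun_apply ms x\<bar> \<le> norm ms * norm x" "\<bar>blinfun_apply w m\<bar> \<le> norm w * norm m"
    "\<bar>blinfun_apply ms m\<bar> \<le> norm ms * norm m"
    using norm_blinfun[of ms x] norm_blinfun[of w m] norm_blinfun[of ms m] by simp_all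
  moreover have "norm ms * norm x \<le> norm ms * c" "norm w * norm m \<le> 2 * c * norm m"
    using assms by (auto intro!: mult_left_mono mult_right_mono)
  ultimately show ?thesis
    using 1 2 unfolding primal_value_def by linarith
qed

text \<open>\<open>p\<close> and \<open>q\<close> shift the squares and \<open>d\<close> decouples
  the two copies of \<open>x\<close>. Projecting onto perturbation and value describes the perturbed
  infimum without forming it or asking that it be attained.\<close>

definition perturbation_epigraph :: "('a::real_normed_vector \<times> ('a \<Rightarrow>\<^sub>L real)) set \<Rightarrow> ('a \<times> ('a \<Rightarrow>\<^sub>L real)) set \<Rightarrow>
    'a \<Rightarrow> ('a \<Rightarrow>\<^sub>L real) \<Rightarrow> (('a \<times> 'a \<times> ('a \<Rightarrow>\<^sub>L real)) \<times> real) set" where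
  "perturbation_epigraph A B m ms = {((p, d, q), a) | p d q a. \<exists>x y x' y' \<alpha> \<beta>.
     (x, y) \<in> fitz_sublevel A \<alpha> \<and> (x', y') \<in> fitz_sublevel B \<beta> \<and> x - x' = d \<and>
     \<alpha> + \<beta> + primal_value m ms p q x (y + y') \<le> a}"

lemma perturbation_epigraphI:
  assumes "(x, y) \<in> fitz_sublevel A \<alpha>" "(x', y') \<in> fitz_sublevel B \<beta>" "x - x' = d"
    "\<alpha> + \<beta> + primal_value m ms p q x (y + y') \<le> a"
  shows "((p, d, q), a) \<in> perturbation_epigraph A B m ms"
  using assms unfolding perturbation_epigraph_def by blast

lemma perturbation_epigraphE:
  assumes "((p, d, q), a) \<in> perturbation_epigraph A B m ms"
  obtains x y x' y' \<alpha> \<beta> where "(x, y) \<in> fitz_sublevel A \<alpha>" "(x', y') \<in> fitz_sublevel B \<beta>" "x - x' = d"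
    "\<alpha> + \<beta> + primal_value m ms p q x (y + y') \<le> a"
  using assms unfolding perturbation_epigraph_def by blast

lemma convex_perturbation_epigraph: "convex (perturbation_epigraph A B m ms)"
proof (rule convexI)
  fix P P' and u v :: real
  assume P: "P \<in> perturbation_epigraph A B m ms" and P': "P' \<in> perturbation_epigraph A B m ms"
    and uv: "0 \<le> u" "0 \<le> v" "u + v = 1"
  obtain p d q a where Pe: "P = ((p, d, q), a)" by (metis surj_pair)
  obtain p' d' q' a' where Pe': "P' = ((p', d', q'), a')" by (metis surj_pair)
  obtain x1 y1 x2 y2 \<alpha> \<beta> where 1: "(x1, y1) \<in> fitz_sublevel A \<alpha>" "(x2, y2) \<in> fitz_sublevel B \<beta>"
    "x1 - x2 = d" "\<alpha> + \<beta> + primal_value m ms p q x1 (y1 + y2) \<le> a"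
    using P unfolding Pe by (rule perturbation_epigraphE)
  obtain x1' y1' x2' y2' \<alpha>' \<beta>' where 2: "(x1', y1') \<in> fitz_sublevel A \<alpha>'" "(x2', y2') \<in> fitz_sublevel B \<beta>'"
    "x1' - x2' = d'" "\<alpha>' + \<beta>' + primal_value m ms p' q' x1' (y1' + y2') \<le> a'"
    using P' unfolding Pe' by (rule perturbation_epigraphE)
  have "((u *\<^sub>R p + v *\<^sub>R p', u *\<^sub>R d + v *\<^sub>R d', u *\<^sub>R q + v *\<^sub>R q'), u * a + v * a')
      \<in> perturbation_epigraph A B m ms"
  proof (rule perturbation_epigraphI)
    show "(u *\<^sub>R x1 + v *\<^sub>R x1', u *\<^sub>R y1 + v *\<^sub>R y1') \<in> fitz_sublevel A (u * \<alpha> + v * \<alpha>')"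
      "(u *\<^sub>R x2 + v *\<^sub>R x2', u *\<^sub>R y2 + v *\<^sub>R y2') \<in> fitz_sublevel B (u * \<beta> + v * \<beta>')"
      by (rule fitz_sublevel_convex_comb[OF 1(1) 2(1) uv] fitz_sublevel_convex_comb[OF 1(2) 2(2) uv])+
    show "u *\<^sub>R x1 + v *\<^sub>R x1' - (u *\<^sub>R x2 + v *\<^sub>R x2') = u *\<^sub>R d + v *\<^sub>R d'"
      unfolding 1(3)[symmetric] 2(3)[symmetric] by (simp add: algebra_simps)
    have w: "u *\<^sub>R y1 + v *\<^sub>R y1' + (u *\<^sub>R y2 + v *\<^sub>R y2') = u *\<^sub>R (y1 + y2) + v *\<^sub>R (y1' + y2')"
      by (simp add: algebra_simps)
    have "u * (\<alpha> + \<beta> + primal_value m ms p q x1 (y1 + y2))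
        + v * (\<alpha>' + \<beta>' + primal_value m ms p' q' x1' (y1' + y2')) \<le> u * a + v * a'"
      using 1(4) 2(4) uv by (intro add_mono mult_left_mono)
    then show "(u * \<alpha> + v * \<alpha>') + (u * \<beta> + v * \<beta>')
        + primal_value m ms (u *\<^sub>R p + v *\<^sub>R p') (u *\<^sub>R q + v *\<^sub>R q') (u *\<^sub>R x1 + v *\<^sub>R x1')
            (u *\<^sub>R y1 + v *\<^sub>R y1' + (u *\<^sub>R y2 + v *\<^sub>R y2')) \<le> u * a + v * a'"
      using primal_value_convex_comb[OF uv, of m ms p p' q q' x1 x1' "y1 + y2" "y1' + y2'"]
      unfolding w by (simp add: distrib_left)
  qed
  then show "u *\<^sub>R P + v *\<^sub>R P' \<in> perturbation_epigraph A B m ms"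
    by (simp add: Pe Pe')
qed

text \<open>At zero perturbation both copies agree, and the pairing bounds make the value
  nonnegative. For the opposite direction, the ball in the cone provides points with bounded levels
  and norms, so one height \<open>M\<close> serves all perturbations.\<close>

lemma perturbation_epigraph_multiplier:
  fixes S T :: "'a::banach \<Rightarrow> ('a \<Rightarrow>\<^sub>L real) set"
  assumes S: "maximal_monotone S" and T: "maximal_monotone T"
    and F: "subspace (fitz_dom_cone S T)" "closed (fitz_dom_cone S T)"
  obtains f :: "('a \<times> 'a \<times> ('a \<Rightarrow>\<^sub>L real)) \<Rightarrow>\<^sub>L real"
  where "\<And>z a. (z, a) \<in> perturbation_epigraph (graph S) (graph T) m ms \<Longrightarrow> blinfun_apply f z \<le> a"
proof -
  let ?W = "perturbation_epigraph (graph S) (graph T) m ms"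
  have F0: "0 \<in> fitz_dom_cone S T" using F(1) by (rule subspace_0)
  obtain r c where r: "r > 0" and ball: "\<And>d. d \<in> fitz_dom_cone S T \<Longrightarrow> norm d < r \<Longrightarrow>
    \<exists>x y x' y'. (x, y) \<in> fitz_sublevel (graph S) c \<and> (x', y') \<in> fitz_sublevel (graph T) c \<and>
      norm x \<le> c \<and> norm y \<le> c \<and> norm x' \<le> c \<and> norm y' \<le> c \<and> x - x' = d"
    using fitz_sublevel_differences_contain_ball[OF F] by blast
  \<comment> \<open>The rescaled perturbation has norm exactly \<open>\<rho>\<close>, while the ball
    condition asks for a strict bound by \<open>r\<close>.\<close>
  define \<rho> where "\<rho> = r / 2"
  have \<rho>: "0 < \<rho>" "\<rho> < r" using r by (auto simp: \<rho>_def)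
  have zero: "0 \<le> a" if "(0, a) \<in> ?W" for a
  proof -
    have "((0, 0, 0), a) \<in> ?W" using that by (simp add: zero_prod_def)
    then obtain x y x' y' \<alpha> \<beta> where 1: "(x, y) \<in> fitz_sublevel (graph S) \<alpha>"
      "(x', y') \<in> fitz_sublevel (graph T) \<beta>" "x - x' = 0"
      "\<alpha> + \<beta> + primal_value m ms 0 0 x (y + y') \<le> a"
      by (rule perturbation_epigraphE)
    have "blinfun_apply y x \<le> \<alpha>" "blinfun_apply y' x \<le> \<beta>"
      using 1(1-3) S T fitz_sublevel_ge_pairing unfolding maximal_monotone_def by (metis eq_iff_diff_eq_0)+
    then show ?thesis
      using 1(4) pairing_add_primal_value_nonneg[of "y + y'" x m ms] by (simp add: blinfun.add_left)
  qed
  define M where "M = c + c + ((c + \<rho> + norm m)\<^sup>2 / 2 + (2 * c + \<rho> + norm ms)\<^sup>2 / 2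
    + norm ms * c + 2 * c * norm m + norm ms * norm m)"
  have qual: "\<exists>b\<le>M. (- (\<rho> / norm z) *\<^sub>R z, b) \<in> ?W" if za: "(z, a) \<in> ?W" and z: "z \<noteq> 0" for z a
  proof -
    obtain p d q where ze: "z = (p, d, q)" by (metis surj_pair)
    define t where "t = - (\<rho> / norm z)"
    have n: "norm z > 0" using z by simp
    have comp: "norm p \<le> norm z" "norm d \<le> norm z" "norm q \<le> norm z"
      unfolding ze
      by (rule norm_fst_le order_trans[OF norm_fst_le norm_snd_le] order_trans[OF norm_snd_le norm_snd_le])+
    have abs_t: "\<bar>t\<bar> * norm z = \<rho>" using n \<rho> by (simp add: t_def)
    have small: "norm (t *\<^sub>R p) \<le> \<rho>" "norm (t *\<^sub>R d) \<le> \<rho>" "norm (t *\<^sub>R q) \<le> \<rho>"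
      unfolding norm_scaleR abs_t[symmetric] using comp by (simp_all add: mult_left_mono)
    \<comment> \<open>Only the component \<open>d\<close> is constrained. It lies in the cone, which
      as a subspace also contains the negative multiple \<open>t *\<^sub>R d\<close>.\<close>
    have "d \<in> fitz_dom_cone S T"
      using za unfolding ze
      by (auto elim!: perturbation_epigraphE intro: fitz_sublevel_diff_in_fitz_dom_cone[OF F0])
    then have "t *\<^sub>R d \<in> fitz_dom_cone S T" by (rule subspace_scale[OF F(1)])
    then obtain x y x' y' where u: "(x, y) \<in> fitz_sublevel (graph S) c" "(x', y') \<in> fitz_sublevel (graph T) c"
      "norm x \<le> c" "norm y \<le> c" "norm x' \<le> c" "norm y' \<le> c" "x - x' = t *\<^sub>R d"
      using ball small(2) \<rho>(2) by (meson le_less_trans)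
    have "norm (y + y') \<le> 2 * c"
      using norm_triangle_ineq[of y y'] u by linarith
    then have "c + c + primal_value m ms (t *\<^sub>R p) (t *\<^sub>R q) x (y + y') \<le> M"
      unfolding M_def using primal_value_le[OF small(1,3) u(3)] by (intro add_left_mono)
    then have "((t *\<^sub>R p, t *\<^sub>R d, t *\<^sub>R q), M) \<in> ?W"
      by (rule perturbation_epigraphI[OF u(1,2,7)])
    then have "(t *\<^sub>R z, M) \<in> ?W" by (simp add: ze)
    then show ?thesis
      unfolding t_def by blast
  qed
  show ?thesis
  proof (rule lagrange_multiplier[OF convex_perturbation_epigraph \<rho>(1)])
    show "\<And>a. (0, a) \<in> ?W \<Longrightarrow> 0 \<le> a" by (rule zero)
    show "\<And>z a. (z, a) \<in> ?W \<Longrightarrow> z \<noteq> 0 \<Longrightarrow> \<exists>b\<le>M. (- (\<rho> / norm z) *\<^sub>R z, b) \<in> ?W" by (rule qual)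
    fix f assume "\<And>z a. (z, a) \<in> ?W \<Longrightarrow> blinfun_apply f z \<le> a"
    then show thesis by (rule that)
  qed
qed

text \<open>The functional is restricted to each factor. On the third, a dual space, the restriction
  belongs to the bidual and is evaluation at some \<open>c\<close>.\<close>

lemma reflexive_triple_functional:
  fixes f :: "('a::banach \<times> 'a \<times> ('a \<Rightarrow>\<^sub>L real)) \<Rightarrow>\<^sub>L real"
  assumes "reflexive_space TYPE('a)"
  obtains a b :: "'a \<Rightarrow>\<^sub>L real" and c :: 'a
  where "\<And>p d q. blinfun_apply f (p, d, q) = blinfun_apply a p + blinfun_apply b d + blinfun_apply q c"
proof -
  have inj: "bounded_linear (\<lambda>p::'a. (p, 0::'a, 0::'a \<Rightarrow>\<^sub>L real))"
    "bounded_linear (\<lambda>d::'a. (0::'a, d, 0::'a \<Rightarrow>\<^sub>L real))"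
    "bounded_linear (\<lambda>q::'a \<Rightarrow>\<^sub>L real. (0::'a, 0::'a, q))"
    by (rule bounded_linear_Pair bounded_linear_ident bounded_linear_zero)+
  note bl = inj[THEN bounded_linear_compose[OF blinfun.bounded_linear_right[of f]]]
  obtain c where "\<forall>q. blinfun_apply (Blinfun (\<lambda>q. blinfun_apply f (0, 0, q))) q = blinfun_apply q c"
    using assms[unfolded reflexive_space_def, THEN spec] by (rule exE)
  then have c: "blinfun_apply f (0, 0, q) = blinfun_apply q c" for q
    by (simp add: bounded_linear_Blinfun_apply[OF bl(3)])
  show ?thesis
  proof
    fix p d q
    show "blinfun_apply f (p, d, q) = blinfun_apply (Blinfun (\<lambda>p. blinfun_apply f (p, 0, 0))) p
        + blinfun_apply (Blinfun (\<lambda>d. blinfun_apply f (0, d, 0))) d + blinfun_apply q c"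
      using blinfun.add_right[of f "(p, 0, 0)" "(0, d, q)"] blinfun.add_right[of f "(0, d, 0)" "(0, 0, q)"]
      by (simp add: bounded_linear_Blinfun_apply[OF bl(1)] bounded_linear_Blinfun_apply[OF bl(2)] c)
  qed
qed

section \<open>Sums of maximally monotone multifunctions\<close>

lemma monotone_graph_mf_sum:
  assumes "monotone_graph (graph S)" "monotone_graph (graph T)"
  shows "monotone_graph (graph (mf_sum S T))"
proof -
  have "0 \<le> blinfun_apply ((y + z) - (y' + z')) (x - x')"
    if "y \<in> S x" "z \<in> T x" "y' \<in> S x'" "z' \<in> T x'" for x x' y y' z z'
  proof -
    have "0 \<le> blinfun_apply (y - y') (x - x')" "0 \<le> blinfun_apply (z - z') (x - x')"
      using assms that by (auto simp: monotone_graph_def graph_def)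
    then show ?thesis by (simp add: blinfun.diff_left blinfun.add_left)
  qed
  then show ?thesis
    unfolding monotone_graph_def graph_def mf_sum_def by blast
qed

lemma mf_sum_mem_of_monotonically_related:
  fixes S T :: "'a::banach \<Rightarrow> ('a \<Rightarrow>\<^sub>L real) set"
  assumes refl: "reflexive_space TYPE('a)"
    and S: "maximal_monotone S" and T: "maximal_monotone T"
    and F: "subspace (fitz_dom_cone S T)" "closed (fitz_dom_cone S T)"
    and rel: "\<And>x y. (x, y) \<in> graph (mf_sum S T) \<Longrightarrow> 0 \<le> blinfun_apply (y - ms) (x - m)"
  shows "(m, ms) \<in> graph (mf_sum S T)"
proof -
  obtain f where f: "\<And>z a. (z, a) \<in> perturbation_epigraph (graph S) (graph T) m ms \<Longrightarrow> blinfun_apply f z \<le> a"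
    using perturbation_epigraph_multiplier[OF S T F] by blast
  obtain a b c where abc: "\<And>p d q. blinfun_apply f (p, d, q) = blinfun_apply a p + blinfun_apply b d + blinfun_apply q c"
    using reflexive_triple_functional[OF refl] by blast
  \<comment> \<open>The Fenchel-Young gap of \<open>a\<close> and \<open>c\<close> for half the
    squared norm, hence nonnegative.\<close>
  define R where "R = (norm a)\<^sup>2 / 2 + (norm c)\<^sup>2 / 2 - blinfun_apply a c"
  have R: "0 \<le> R"
    using pairing_bound[of c "- a"] by (simp add: R_def blinfun.minus_left)
  have sum: "R \<le> blinfun_apply (t - (ms + a + b)) (s - (m - c)) + blinfun_apply (t' - (- b)) (s' - (m - c))"
    (is "_ \<le> ?E") if st: "(s, t) \<in> graph S" and st': "(s', t') \<in> graph T" for s t s' t'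
  proof -
    \<comment> \<open>The shifts are solved for so that the arguments of the two squares become
      \<open>h\<close> and \<open>k\<close>. These are then free, and each can be eliminated by its
      own conjugate.\<close>
    have *: "0 \<le> (?E + blinfun_apply a c + (norm k)\<^sup>2 / 2 - blinfun_apply k c)
        + (norm h)\<^sup>2 / 2 + blinfun_apply a h" for h k
    proof -
      have "((s - m - h, s - s', k + ms - t - t'),
          blinfun_apply t s + blinfun_apply t' s' + primal_value m ms (s - m - h) (k + ms - t - t') s (t + t'))
        \<in> perturbation_epigraph (graph S) (graph T) m ms"
        using S T st st' unfolding maximal_monotone_def maximal_monotone_graph_def
        by (intro perturbation_epigraphI[OF graph_subset_fitz_sublevel graph_subset_fitz_sublevel]) auto
      from f[OF this] show ?thesis
        unfolding abc primal_value_def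
        by (simp add: blinfun.add_left blinfun.add_right blinfun.diff_left blinfun.diff_right algebra_simps)
    qed
    have "(norm a)\<^sup>2 / 2 \<le> ?E + blinfun_apply a c + (norm k)\<^sup>2 / 2 - blinfun_apply k c" for k
      using * by (rule half_norm_square_conjugate_le)
    then have "0 \<le> (?E + blinfun_apply a c - (norm a)\<^sup>2 / 2) + (norm k)\<^sup>2 / 2 - blinfun_apply k c" for k
      by (simp add: algebra_simps)
    then have "(norm c)\<^sup>2 / 2 \<le> ?E + blinfun_apply a c - (norm a)\<^sup>2 / 2"
      by (rule half_dual_norm_square_conjugate_le)
    then show ?thesis unfolding R_def by linarith
  qed
  \<comment> \<open>The multiplier \<open>b\<close> of the decoupling splits \<open>ms + a\<close>
    into a value of \<open>S\<close> and a value of \<open>T\<close> at the common point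
    \<open>m - c\<close>.\<close>
  have memS: "(m - c, ms + a + b) \<in> graph S" and memT: "(m - c, - b) \<in> graph T"
    using maximal_monotone_pair_mem[OF S[unfolded maximal_monotone_def] T[unfolded maximal_monotone_def] R sum]
    by blast+
  have "(ms + a + b) + (- b) \<in> mf_sum S T (m - c)"
    using memS memT unfolding graph_def mf_sum_def by blast
  then have mem: "(m - c, ms + a) \<in> graph (mf_sum S T)"
    by (simp add: graph_def)
  have "R \<le> 0" using sum[OF memS memT] by simp
  moreover have "blinfun_apply a c \<le> 0"
    using rel[OF mem] by (simp add: blinfun.minus_right)
  ultimately have "(norm a)\<^sup>2 + (norm c)\<^sup>2 \<le> 0"
    unfolding R_def by linarith
  then have "a = 0" "c = 0"
    by (simp_all add: sum_power2_le_zero_iff)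
  then show ?thesis using mem by simp
qed

theorem theorem6p5:
  fixes S T :: "'a::banach \<Rightarrow> ('a \<Rightarrow>\<^sub>L real) set"
  assumes "\<exists>x::'a. x \<noteq> 0"
    and "reflexive_space TYPE('a)"
    and "maximal_monotone S" and "maximal_monotone T"
    and "subspace (\<Union>c\<in>{0<..}. (\<lambda>v. c *\<^sub>R v) ` {a - b | a b. a \<in> fst ` fitz_dom S \<and> b \<in> fst ` fitz_dom T})"
    and "closed (\<Union>c\<in>{0<..}. (\<lambda>v. c *\<^sub>R v) ` {a - b | a b. a \<in> fst ` fitz_dom S \<and> b \<in> fst ` fitz_dom T})"
  shows "maximal_monotone (mf_sum S T)"
  unfolding maximal_monotone_def maximal_monotone_graph_def
proof (intro conjI allI impI)
  show "monotone_graph (graph (mf_sum S T))"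
    using assms(3,4) by (intro monotone_graph_mf_sum) (auto simp: maximal_monotone_def maximal_monotone_graph_def)
  fix G' assume G': "monotone_graph G' \<and> graph (mf_sum S T) \<subseteq> G'"
  have "(m, ms) \<in> graph (mf_sum S T)" if "(m, ms) \<in> G'" for m ms
  proof (rule mf_sum_mem_of_monotonically_related[OF assms(2-6)[folded fitz_dom_cone_def]])
    fix x y assume "(x, y) \<in> graph (mf_sum S T)"
    then show "0 \<le> blinfun_apply (y - ms) (x - m)"
      using G' that unfolding monotone_graph_def by blast
  qed
  then show "G' = graph (mf_sum S T)"
    using G' by auto
qed

end
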